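(* Let $U$ be any consistent theory in the language of arithmetic that extends the Tarski–Mostowski–Robinson theory $\mathsf{R}$ (no restriction is placed on the complexity of the axiom set of $U$). Then there is no formula $\rho(x)$ (of any complexity) satisfying both of the following: (Independence) for every sentence $\phi$, if $U+\phi$ is consistent, then both $U+\phi+\rho(\ulcorner\phi\urcorner)$ and $U+\phi+\neg\rho(\ulcorner\phi\urcorner)$ are consistent; (Extensionality) for all sentences $\phi,\psi$, if $U\vdash\phi\leftrightarrow\psi$, then $U\vdash\rho(\ulcorner\phi\urcorner)\leftrightarrow\rho(\ulcorner\psi\urcorner)$.
   Context: $\ulcorner\phi\urcorner$ denotes the numeral of the Gödel number of $\phi$ under a standard Gödel numbering. A formula satisfying Independence and Extensionality over $U$ is called an extensional Rosser formula over $U$. *)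

theory Defs
  imports Main "HOL-Library.Nat_Bijection"
begin

text \<open>Classical first-order logic with equality in the language $0, S, +, \times$ of arithmetic.
  Bound variables are de Bruijn indices: the variable bound by the innermost enclosing
  quantifier is \<^term>\<open>0::nat\<close>.\<close>

datatype tm = Var nat | Zero | Succ tm | Add tm tm | Mul tm tm

datatype fm = Eq tm tm | Fls | Imp fm fm | All fm

primrec subst_tm :: "(nat \<Rightarrow> tm) \<Rightarrow> tm \<Rightarrow> tm" where
  "subst_tm \<sigma> (Var i) = \<sigma> i"
| "subst_tm \<sigma> Zero = Zero"
| "subst_tm \<sigma> (Succ t) = Succ (subst_tm \<sigma> t)"
| "subst_tm \<sigma> (Add s t) = Add (subst_tm \<sigma> s) (subst_tm \<sigma> t)"
| "subst_tm \<sigma> (Mul s t) = Mul (subst_tm \<sigma> s) (subst_tm \<sigma> t)"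

definition lift_tm :: "tm \<Rightarrow> tm" where
  "lift_tm = subst_tm (\<lambda>i. Var (Suc i))"

primrec subst_fm :: "(nat \<Rightarrow> tm) \<Rightarrow> fm \<Rightarrow> fm" where
  "subst_fm \<sigma> (Eq s t) = Eq (subst_tm \<sigma> s) (subst_tm \<sigma> t)"
| "subst_fm \<sigma> Fls = Fls"
| "subst_fm \<sigma> (Imp \<phi> \<psi>) = Imp (subst_fm \<sigma> \<phi>) (subst_fm \<sigma> \<psi>)"
| "subst_fm \<sigma> (All \<phi>) = All (subst_fm (case_nat (Var 0) (\<lambda>i. lift_tm (\<sigma> i))) \<phi>)"

definition lift_fm :: "fm \<Rightarrow> fm" where
  "lift_fm = subst_fm (\<lambda>i. Var (Suc i))"

text \<open>Instantiation of the variable with index 0; the remaining free variables move down by one,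
  as required when a quantifier is removed.\<close>

definition inst :: "fm \<Rightarrow> tm \<Rightarrow> fm" where
  "inst \<phi> t = subst_fm (case_nat t Var) \<phi>"

primrec fv_tm :: "tm \<Rightarrow> nat set" where
  "fv_tm (Var i) = {i}"
| "fv_tm Zero = {}"
| "fv_tm (Succ t) = fv_tm t"
| "fv_tm (Add s t) = fv_tm s \<union> fv_tm t"
| "fv_tm (Mul s t) = fv_tm s \<union> fv_tm t"

primrec fv :: "fm \<Rightarrow> nat set" where
  "fv (Eq s t) = fv_tm s \<union> fv_tm t"
| "fv Fls = {}"
| "fv (Imp \<phi> \<psi>) = fv \<phi> \<union> fv \<psi>"
| "fv (All \<phi>) = {i. Suc i \<in> fv \<phi>}"

definition sentence :: "fm \<Rightarrow> bool" where
  "sentence \<phi> \<longleftrightarrow> fv \<phi> = {}"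

definition Neg :: "fm \<Rightarrow> fm" where
  "Neg \<phi> = Imp \<phi> Fls"

definition Disj :: "fm \<Rightarrow> fm \<Rightarrow> fm" where
  "Disj \<phi> \<psi> = Imp (Neg \<phi>) \<psi>"

definition Conj :: "fm \<Rightarrow> fm \<Rightarrow> fm" where
  "Conj \<phi> \<psi> = Neg (Imp \<phi> (Neg \<psi>))"

definition Iff :: "fm \<Rightarrow> fm \<Rightarrow> fm" where
  "Iff \<phi> \<psi> = Conj (Imp \<phi> \<psi>) (Imp \<psi> \<phi>)"

definition Ex :: "fm \<Rightarrow> fm" where
  "Ex \<phi> = Neg (All (Neg \<phi>))"

text \<open>Classical natural deduction. Lifting the context in \<open>AllI\<close> makes index 0 a fresh variable
  (the eigenvariable condition).\<close>

inductive proves :: "fm set \<Rightarrow> fm \<Rightarrow> bool" (infix "\<turnstile>" 50) where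
  Hyp: "\<phi> \<in> \<Gamma> \<Longrightarrow> \<Gamma> \<turnstile> \<phi>"
| ImpI: "insert \<phi> \<Gamma> \<turnstile> \<psi> \<Longrightarrow> \<Gamma> \<turnstile> Imp \<phi> \<psi>"
| ImpE: "\<Gamma> \<turnstile> Imp \<phi> \<psi> \<Longrightarrow> \<Gamma> \<turnstile> \<phi> \<Longrightarrow> \<Gamma> \<turnstile> \<psi>"
| Raa: "insert (Neg \<phi>) \<Gamma> \<turnstile> Fls \<Longrightarrow> \<Gamma> \<turnstile> \<phi>"
| AllI: "lift_fm ` \<Gamma> \<turnstile> \<phi> \<Longrightarrow> \<Gamma> \<turnstile> All \<phi>"
| AllE: "\<Gamma> \<turnstile> All \<phi> \<Longrightarrow> \<Gamma> \<turnstile> inst \<phi> t"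
| EqRefl: "\<Gamma> \<turnstile> Eq t t"
| EqSubst: "\<Gamma> \<turnstile> Eq s t \<Longrightarrow> \<Gamma> \<turnstile> inst \<phi> s \<Longrightarrow> \<Gamma> \<turnstile> inst \<phi> t"

text \<open>A theory is an arbitrary set of sentences, thought of as its axioms.\<close>

definition is_theory :: "fm set \<Rightarrow> bool" where
  "is_theory U \<longleftrightarrow> (\<forall>\<phi>\<in>U. sentence \<phi>)"

definition consistent :: "fm set \<Rightarrow> bool" where
  "consistent U \<longleftrightarrow> \<not> U \<turnstile> Fls"

definition extends :: "fm set \<Rightarrow> fm set \<Rightarrow> bool" where
  "extends U T \<longleftrightarrow> (\<forall>\<phi>. sentence \<phi> \<longrightarrow> T \<turnstile> \<phi> \<longrightarrow> U \<turnstile> \<phi>)"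

primrec num :: "nat \<Rightarrow> tm" where
  "num 0 = Zero"
| "num (Suc n) = Succ (num n)"

text \<open>As in Tarski, Mostowski and Robinson, $x \le y$ is not primitive but stands for
  $\exists z\,(z + x = y)$.\<close>

definition Le :: "tm \<Rightarrow> tm \<Rightarrow> fm" where
  "Le s t = Ex (Eq (Add (Var 0) (lift_tm s)) (lift_tm t))"

text \<open>\<open>eq_upto t n\<close> is the disjunction of the equations \<open>t = num i\<close> for \<open>i \<le> n\<close>.\<close>

primrec eq_upto :: "tm \<Rightarrow> nat \<Rightarrow> fm" where
  "eq_upto t 0 = Eq t (num 0)"
| "eq_upto t (Suc n) = Disj (eq_upto t n) (Eq t (num (Suc n)))"

inductive_set theory_R :: "fm set" where
  "Eq (Add (num m) (num n)) (num (m + n)) \<in> theory_R"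
| "Eq (Mul (num m) (num n)) (num (m * n)) \<in> theory_R"
| "m \<noteq> n \<Longrightarrow> Neg (Eq (num m) (num n)) \<in> theory_R"
| "All (Imp (Le (Var 0) (num n)) (eq_upto (Var 0) n)) \<in> theory_R"
| "All (Disj (Le (Var 0) (num n)) (Le (num n) (Var 0))) \<in> theory_R"

text \<open>The Goedel numbering, by recursion on syntax with Cantor's pairing function.\<close>

primrec gn_tm :: "tm \<Rightarrow> nat" where
  "gn_tm (Var i) = prod_encode (0, i)"
| "gn_tm Zero = prod_encode (1, 0)"
| "gn_tm (Succ t) = prod_encode (2, gn_tm t)"
| "gn_tm (Add s t) = prod_encode (3, prod_encode (gn_tm s, gn_tm t))"
| "gn_tm (Mul s t) = prod_encode (4, prod_encode (gn_tm s, gn_tm t))"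

primrec gn :: "fm \<Rightarrow> nat" where
  "gn (Eq s t) = prod_encode (0, prod_encode (gn_tm s, gn_tm t))"
| "gn Fls = prod_encode (1, 0)"
| "gn (Imp \<phi> \<psi>) = prod_encode (2, prod_encode (gn \<phi>, gn \<psi>))"
| "gn (All \<phi>) = prod_encode (3, gn \<phi>)"

lemma gn_tm_inject: "gn_tm s = gn_tm t \<longleftrightarrow> s = t"
proof (induction s arbitrary: t)
  case (Var i) then show ?case by (cases t) auto
next
  case Zero then show ?case by (cases t) auto
next
  case (Succ s) then show ?case by (cases t) auto
next
  case (Add s1 s2) then show ?case by (cases t) auto
next
  case (Mul s1 s2) then show ?case by (cases t) auto
qed

lemma gn_inject: "gn \<phi> = gn \<psi> \<longleftrightarrow> \<phi> = \<psi>"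
proof (induction \<phi> arbitrary: \<psi>)
  case (Eq s t) then show ?case by (cases \<psi>) (auto simp: gn_tm_inject)
next
  case Fls then show ?case by (cases \<psi>) auto
next
  case (Imp \<phi>1 \<phi>2) then show ?case by (cases \<psi>) auto
next
  case (All \<phi>) then show ?case by (cases \<psi>) auto
qed

definition gquote :: "fm \<Rightarrow> tm" where
  "gquote \<phi> = num (gn \<phi>)"

text \<open>Below, \<open>\<rho>\<close> is a formula whose only free variable (if any) has index 0, so
  \<open>inst \<rho> t\<close> is $\rho(t)$.\<close>

definition independence :: "fm set \<Rightarrow> fm \<Rightarrow> bool" where
  "independence U \<rho> \<longleftrightarrow>
    (\<forall>\<phi>. sentence \<phi> \<longrightarrow> consistent (U \<union> {\<phi>}) \<longrightarrow>
       consistent (U \<union> {\<phi>} \<union> {inst \<rho> (gquote \<phi>)}) \<and>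
       consistent (U \<union> {\<phi>} \<union> {Neg (inst \<rho> (gquote \<phi>))}))"

definition extensionality :: "fm set \<Rightarrow> fm \<Rightarrow> bool" where
  "extensionality U \<rho> \<longleftrightarrow>
    (\<forall>\<phi> \<psi>. sentence \<phi> \<longrightarrow> sentence \<psi> \<longrightarrow> U \<turnstile> Iff \<phi> \<psi> \<longrightarrow>
       U \<turnstile> Iff (inst \<rho> (gquote \<phi>)) (inst \<rho> (gquote \<psi>)))"

definition extensional_Rosser_formula :: "fm set \<Rightarrow> fm \<Rightarrow> bool" where
  "extensional_Rosser_formula U \<rho> \<longleftrightarrow>
    fv \<rho> \<subseteq> {0} \<and> independence U \<rho> \<and> extensionality U \<rho>"

end

theory Submission
  imports Defs "HOL-Number_Theory.Cong"
begin

text \<open>If \<open>\<theta>\<close> is a fixed point of \<open>\<rho>\<close>, then \<open>U + \<theta>\<close> proves \<open>\<rho>(\<theta>)\<close>, so by independence \<open>U\<close> refutes \<open>\<theta>\<close>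
  and hence \<open>\<rho>(\<theta>)\<close>; since \<open>\<theta>\<close> is then equivalent to falsity, extensionality makes \<open>U\<close> refute
  \<open>\<rho>(Fls)\<close>. A fixed point of the negation of \<open>\<rho>\<close> shows in the same way that \<open>U\<close> proves \<open>\<rho>(Fls)\<close>.
  Fixed points exist over R because the function sending the code \<open>n\<close> of \<open>\<phi>\<close> to the code of
  \<open>\<forall>x. x = num n \<longrightarrow> \<phi>\<close> has a graph definable by a bounded formula with one unbounded witness.\<close>

section \<open>Substitution\<close>

lemma subst_tm_comp: "subst_tm \<tau> (subst_tm \<sigma> t) = subst_tm (\<lambda>i. subst_tm \<tau> (\<sigma> i)) t"
  by (induction t) auto

lemma subst_tm_Var [simp]: "subst_tm Var t = t"
  by (induction t) auto

lemma subst_tm_lift: "subst_tm \<sigma> (lift_tm t) = subst_tm (\<lambda>i. \<sigma> (Suc i)) t"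
  by (simp add: lift_tm_def subst_tm_comp)

lemma lift_subst_tm: "lift_tm (subst_tm \<sigma> t) = subst_tm (\<lambda>i. lift_tm (\<sigma> i)) t"
  by (simp add: lift_tm_def subst_tm_comp)

lemma lift_tm_simps [simp]:
  "lift_tm (Var i) = Var (Suc i)" "lift_tm Zero = Zero" "lift_tm (Succ t) = Succ (lift_tm t)"
  "lift_tm (Add s t) = Add (lift_tm s) (lift_tm t)" "lift_tm (Mul s t) = Mul (lift_tm s) (lift_tm t)"
  by (simp_all add: lift_tm_def)

text \<open>Under a binder index 0 stays fixed and the other images are lifted. Lifting commutes
  with substitution, so the adjusted substitutions compose to the adjusted composite.\<close>

lemma subst_fm_comp: "subst_fm \<tau> (subst_fm \<sigma> \<phi>) = subst_fm (\<lambda>i. subst_tm \<tau> (\<sigma> i)) \<phi>"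
proof (induction \<phi> arbitrary: \<sigma> \<tau>)
  case (All \<phi>)
  have "(\<lambda>i. subst_tm (case_nat (Var 0) (\<lambda>i. lift_tm (\<tau> i))) (case_nat (Var 0) (\<lambda>i. lift_tm (\<sigma> i)) i))
      = case_nat (Var 0) (\<lambda>i. lift_tm (subst_tm \<tau> (\<sigma> i)))"
    by (rule ext) (simp add: subst_tm_lift lift_subst_tm split: nat.split)
  then show ?case by (simp add: All.IH)
qed (simp_all add: subst_tm_comp)

lemma case_nat_Var: "case_nat (Var 0) (\<lambda>i. Var (Suc i)) = Var"
  by (rule ext) (simp split: nat.split)

lemma subst_fm_Var [simp]: "subst_fm Var \<phi> = \<phi>"
  by (induction \<phi>) (simp_all add: case_nat_Var)

text \<open>Computes an instance of a universal formula to which a substitution has already been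
  applied: instantiation undoes the lifting of the images.\<close>

lemma inst_subst_fm:
  "inst (subst_fm (case_nat (Var 0) (\<lambda>i. lift_tm (\<sigma> i))) \<phi>) t = subst_fm (case_nat t \<sigma>) \<phi>"
proof -
  have "(\<lambda>i. subst_tm (case_nat t Var) (case_nat (Var 0) (\<lambda>i. lift_tm (\<sigma> i)) i)) = case_nat t \<sigma>"
    by (rule ext) (simp add: subst_tm_lift split: nat.split)
  then show ?thesis by (simp add: inst_def subst_fm_comp)
qed

lemma subst_tm_cong: "(\<And>i. i \<in> fv_tm t \<Longrightarrow> \<sigma> i = \<tau> i) \<Longrightarrow> subst_tm \<sigma> t = subst_tm \<tau> t"
  by (induction t) auto

lemma subst_fm_cong: "(\<And>i. i \<in> fv \<phi> \<Longrightarrow> \<sigma> i = \<tau> i) \<Longrightarrow> subst_fm \<sigma> \<phi> = subst_fm \<tau> \<phi>"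
proof (induction \<phi> arbitrary: \<sigma> \<tau>)
  case (Eq s t)
  then show ?case using subst_tm_cong[of s \<sigma> \<tau>] subst_tm_cong[of t \<sigma> \<tau>] by auto
next
  case (Imp \<phi> \<psi>)
  then show ?case by (metis UnCI fv.simps(3) subst_fm.simps(3))
next
  case (All \<phi>)
  have "subst_fm (case_nat (Var 0) (\<lambda>i. lift_tm (\<sigma> i))) \<phi>
      = subst_fm (case_nat (Var 0) (\<lambda>i. lift_tm (\<tau> i))) \<phi>"
    using All.prems by (intro All.IH) (auto split: nat.split)
  then show ?case by simp
qed simp

lemma sentence_subst: "sentence \<phi> \<Longrightarrow> subst_fm \<sigma> \<phi> = \<phi>"
  using subst_fm_cong[of \<phi> \<sigma> Var] by (simp add: sentence_def)

lemma fv_subst_tm: "fv_tm (subst_tm \<sigma> t) = (\<Union>i\<in>fv_tm t. fv_tm (\<sigma> i))"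
  by (induction t) auto

lemma fv_lift_tm [simp]: "fv_tm (lift_tm t) = Suc ` fv_tm t"
  by (auto simp: lift_tm_def fv_subst_tm)

lemma fv_subst_fm: "fv (subst_fm \<sigma> \<phi>) = (\<Union>i\<in>fv \<phi>. fv_tm (\<sigma> i))"
proof (induction \<phi> arbitrary: \<sigma>)
  case (All \<phi>)
  have "Suc i \<in> fv_tm (case_nat (Var 0) (\<lambda>i. lift_tm (\<sigma> i)) j) \<longleftrightarrow>
      (\<exists>k. j = Suc k \<and> i \<in> fv_tm (\<sigma> k))" for i j
    by (cases j) auto
  then show ?case by (auto simp: All.IH)
qed (auto simp: fv_subst_tm)

lemma fv_num [simp]: "fv_tm (num n) = {}"
  by (induction n) auto

lemma subst_num [simp]: "subst_tm \<sigma> (num n) = num n"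
  by (induction n) auto

lemma lift_num [simp]: "lift_tm (num n) = num n"
  by (simp add: lift_tm_def)

definition BAll :: "tm \<Rightarrow> fm \<Rightarrow> fm" where
  "BAll t \<phi> = All (Imp (Le (Var 0) (lift_tm t)) \<phi>)"

definition BEx :: "tm \<Rightarrow> fm \<Rightarrow> fm" where
  "BEx t \<phi> = Neg (BAll t (Neg \<phi>))"

lemma subst_connectives [simp]:
  "subst_fm \<sigma> (Neg \<phi>) = Neg (subst_fm \<sigma> \<phi>)"
  "subst_fm \<sigma> (Disj \<phi> \<psi>) = Disj (subst_fm \<sigma> \<phi>) (subst_fm \<sigma> \<psi>)"
  "subst_fm \<sigma> (Conj \<phi> \<psi>) = Conj (subst_fm \<sigma> \<phi>) (subst_fm \<sigma> \<psi>)"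
  "subst_fm \<sigma> (Ex \<phi>) = Ex (subst_fm (case_nat (Var 0) (\<lambda>i. lift_tm (\<sigma> i))) \<phi>)"
  by (simp_all add: Neg_def Disj_def Conj_def Ex_def)

lemma subst_Le [simp]: "subst_fm \<sigma> (Le s t) = Le (subst_tm \<sigma> s) (subst_tm \<sigma> t)"
  by (simp add: Le_def subst_tm_lift lift_subst_tm)

lemma subst_BAll [simp]:
  "subst_fm \<sigma> (BAll t \<phi>) = BAll (subst_tm \<sigma> t) (subst_fm (case_nat (Var 0) (\<lambda>i. lift_tm (\<sigma> i))) \<phi>)"
  by (simp add: BAll_def subst_tm_lift lift_subst_tm)

lemma subst_BEx [simp]:
  "subst_fm \<sigma> (BEx t \<phi>) = BEx (subst_tm \<sigma> t) (subst_fm (case_nat (Var 0) (\<lambda>i. lift_tm (\<sigma> i))) \<phi>)"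
  by (simp add: BEx_def)

lemma subst_eq_upto [simp]: "subst_fm \<sigma> (eq_upto t n) = eq_upto (subst_tm \<sigma> t) n"
  by (induction n) auto

lemma fv_connectives [simp]:
  "fv (Neg \<phi>) = fv \<phi>" "fv (Disj \<phi> \<psi>) = fv \<phi> \<union> fv \<psi>" "fv (Ex \<phi>) = {i. Suc i \<in> fv \<phi>}"
  by (simp_all add: Neg_def Disj_def Ex_def)

lemma fv_Le [simp]: "fv (Le s t) = fv_tm s \<union> fv_tm t"
  by (auto simp: Le_def)

lemma fv_eq_upto [simp]: "fv (eq_upto t n) = fv_tm t"
  by (induction n) auto

lemma sentence_theory_R: "\<phi> \<in> theory_R \<Longrightarrow> sentence \<phi>"
  by (induction rule: theory_R.induct) (auto simp: sentence_def)

section \<open>Derived rules\<close>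

lemma weaken: "\<Gamma> \<turnstile> \<phi> \<Longrightarrow> \<Gamma> \<subseteq> \<Delta> \<Longrightarrow> \<Delta> \<turnstile> \<phi>"
proof (induction arbitrary: \<Delta> rule: proves.induct)
  case (ImpI \<phi> \<Gamma> \<psi>) then show ?case by (meson insert_mono proves.ImpI)
next
  case (Raa \<phi> \<Gamma>) then show ?case by (meson insert_mono proves.Raa)
next
  case (AllI \<Gamma> \<phi>) then show ?case by (meson image_mono proves.AllI)
qed (blast intro: proves.intros)+

lemma weaken_insert: "\<Gamma> \<turnstile> \<phi> \<Longrightarrow> insert \<psi> \<Gamma> \<turnstile> \<phi>"
  by (rule weaken) auto

lemma Hyp_insert: "insert \<phi> \<Gamma> \<turnstile> \<phi>"
  by (rule Hyp) simp

lemma cut: "\<Gamma> \<turnstile> \<phi> \<Longrightarrow> insert \<phi> \<Gamma> \<turnstile> \<psi> \<Longrightarrow> \<Gamma> \<turnstile> \<psi>"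
  by (meson ImpI ImpE)

lemma FlsE: "\<Gamma> \<turnstile> Fls \<Longrightarrow> \<Gamma> \<turnstile> \<phi>"
  by (rule Raa, rule weaken_insert)

lemma NegI: "insert \<phi> \<Gamma> \<turnstile> Fls \<Longrightarrow> \<Gamma> \<turnstile> Neg \<phi>"
  by (simp add: Neg_def ImpI)

lemma NegE: "\<Gamma> \<turnstile> Neg \<phi> \<Longrightarrow> \<Gamma> \<turnstile> \<phi> \<Longrightarrow> \<Gamma> \<turnstile> \<psi>"
  unfolding Neg_def by (meson ImpE FlsE)

lemma DisjE:
  assumes "\<Gamma> \<turnstile> Disj \<phi> \<psi>" "insert \<phi> \<Gamma> \<turnstile> \<chi>" "insert \<psi> \<Gamma> \<turnstile> \<chi>"
  shows "\<Gamma> \<turnstile> \<chi>"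
proof (rule Raa)
  let ?\<Delta> = "insert (Neg \<chi>) \<Gamma>"
  have "?\<Delta> \<turnstile> Neg \<phi>"
  proof (rule NegI)
    have "insert \<phi> ?\<Delta> \<turnstile> \<chi>" using assms(2) by (rule weaken) auto
    moreover have "insert \<phi> ?\<Delta> \<turnstile> Neg \<chi>" by (rule Hyp) simp
    ultimately show "insert \<phi> ?\<Delta> \<turnstile> Fls" by (rule NegE[rotated])
  qed
  moreover have "?\<Delta> \<turnstile> Imp (Neg \<phi>) \<psi>"
    using weaken_insert[OF assms(1)] by (simp add: Disj_def)
  ultimately have "?\<Delta> \<turnstile> \<psi>" by (rule ImpE[rotated])
  moreover have "insert \<psi> ?\<Delta> \<turnstile> \<chi>" using assms(3) by (rule weaken) auto
  ultimately have "?\<Delta> \<turnstile> \<chi>" by (rule cut)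
  with Hyp_insert show "?\<Delta> \<turnstile> Fls" by (rule NegE)
qed

lemma ConjI:
  assumes "\<Gamma> \<turnstile> \<phi>" "\<Gamma> \<turnstile> \<psi>"
  shows "\<Gamma> \<turnstile> Conj \<phi> \<psi>"
  unfolding Conj_def
proof (rule NegI)
  let ?\<Delta> = "insert (Imp \<phi> (Neg \<psi>)) \<Gamma>"
  have "?\<Delta> \<turnstile> Neg \<psi>" by (rule ImpE[OF Hyp_insert weaken_insert[OF assms(1)]])
  then show "?\<Delta> \<turnstile> Fls" by (rule NegE[OF _ weaken_insert[OF assms(2)]])
qed

lemma ConjD1:
  assumes "\<Gamma> \<turnstile> Conj \<phi> \<psi>"
  shows "\<Gamma> \<turnstile> \<phi>"
proof (rule Raa)
  have "insert (Neg \<phi>) \<Gamma> \<turnstile> Imp \<phi> (Neg \<psi>)"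
    by (rule ImpI, rule NegE[OF weaken_insert[OF Hyp_insert] Hyp_insert])
  then show "insert (Neg \<phi>) \<Gamma> \<turnstile> Fls"
    by (rule NegE[OF weaken_insert[OF assms[unfolded Conj_def]]])
qed

lemma ConjD2:
  assumes "\<Gamma> \<turnstile> Conj \<phi> \<psi>"
  shows "\<Gamma> \<turnstile> \<psi>"
proof (rule Raa)
  have "insert (Neg \<psi>) \<Gamma> \<turnstile> Imp \<phi> (Neg \<psi>)"
    by (rule ImpI[OF weaken_insert[OF Hyp_insert]])
  then show "insert (Neg \<psi>) \<Gamma> \<turnstile> Fls"
    by (rule NegE[OF weaken_insert[OF assms[unfolded Conj_def]]])
qed

lemma ExI: "\<Gamma> \<turnstile> inst \<phi> t \<Longrightarrow> \<Gamma> \<turnstile> Ex \<phi>"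
  unfolding Ex_def
proof (rule NegI)
  assume *: "\<Gamma> \<turnstile> inst \<phi> t"
  have "insert (All (Neg \<phi>)) \<Gamma> \<turnstile> inst (Neg \<phi>) t" by (rule AllE[OF Hyp_insert])
  then have "insert (All (Neg \<phi>)) \<Gamma> \<turnstile> Neg (inst \<phi> t)" by (simp add: inst_def)
  then show "insert (All (Neg \<phi>)) \<Gamma> \<turnstile> Fls" using weaken_insert[OF *] by (rule NegE)
qed

text \<open>A context of sentences is unchanged by \<open>lift_fm\<close>, so index 0 is
  automatically fresh and \<open>AllI\<close> applies directly.\<close>

lemma AllI_closed:
  assumes "\<And>\<phi>. \<phi> \<in> \<Gamma> \<Longrightarrow> sentence \<phi>" "\<Gamma> \<turnstile> \<phi>"
  shows "\<Gamma> \<turnstile> All \<phi>"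
proof -
  have "lift_fm ` \<Gamma> = \<Gamma>" using assms(1) by (force simp: lift_fm_def sentence_subst)
  with assms(2) show ?thesis by (simp add: AllI)
qed

text \<open>Leibniz's rule for one entry of a simultaneous substitution. Entry \<open>k\<close>
  becomes the hole \<open>Var 0\<close>; the other entries are lifted so that filling the hole with
  \<open>inst\<close> restores them.\<close>

lemma replace:
  assumes agree: "\<And>i. i \<noteq> k \<Longrightarrow> \<sigma> i = \<tau> i"
    and "\<Gamma> \<turnstile> Eq (\<sigma> k) (\<tau> k)" "\<Gamma> \<turnstile> subst_fm \<sigma> \<phi>"
  shows "\<Gamma> \<turnstile> subst_fm \<tau> \<phi>"
proof -
  let ?\<phi> = "subst_fm (\<lambda>i. if i = k then Var 0 else lift_tm (\<sigma> i)) \<phi>"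
  have "inst ?\<phi> (\<sigma> k) = subst_fm \<sigma> \<phi>"
    unfolding inst_def subst_fm_comp by (rule subst_fm_cong) (simp add: subst_tm_lift)
  moreover have "inst ?\<phi> (\<tau> k) = subst_fm \<tau> \<phi>"
    unfolding inst_def subst_fm_comp by (rule subst_fm_cong) (simp add: subst_tm_lift agree)
  ultimately show ?thesis using EqSubst[OF assms(2), of ?\<phi>] assms(3) by simp
qed

text \<open>The formula with a hole is x = s: filled with \<open>s\<close> it is reflexivity, filled
  with \<open>t\<close> it is the goal. The congruence lemmas below vary this choice.\<close>

lemma EqSym:
  assumes "\<Gamma> \<turnstile> Eq s t"
  shows "\<Gamma> \<turnstile> Eq t s"
  using EqSubst[OF assms, of "Eq (Var 0) (lift_tm s)"]
  by (simp add: inst_def subst_tm_lift EqRefl)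

lemma EqTrans:
  assumes "\<Gamma> \<turnstile> Eq s t" "\<Gamma> \<turnstile> Eq t u"
  shows "\<Gamma> \<turnstile> Eq s u"
  using EqSubst[OF assms(2), of "Eq (lift_tm s) (Var 0)"] assms(1)
  by (simp add: inst_def subst_tm_lift)

lemma EqSucc:
  assumes "\<Gamma> \<turnstile> Eq s t"
  shows "\<Gamma> \<turnstile> Eq (Succ s) (Succ t)"
  using EqSubst[OF assms, of "Eq (Succ (lift_tm s)) (Succ (Var 0))"]
  by (simp add: inst_def subst_tm_lift EqRefl)

lemma EqAdd:
  assumes "\<Gamma> \<turnstile> Eq s s'" "\<Gamma> \<turnstile> Eq t t'"
  shows "\<Gamma> \<turnstile> Eq (Add s t) (Add s' t')"
  using EqSubst[OF assms(1), of "Eq (Add (lift_tm s) (lift_tm t)) (Add (Var 0) (lift_tm t))"]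
    EqSubst[OF assms(2), of "Eq (Add (lift_tm s) (lift_tm t)) (Add (lift_tm s') (Var 0))"]
  by (simp add: inst_def subst_tm_lift EqRefl)

lemma EqMul:
  assumes "\<Gamma> \<turnstile> Eq s s'" "\<Gamma> \<turnstile> Eq t t'"
  shows "\<Gamma> \<turnstile> Eq (Mul s t) (Mul s' t')"
  using EqSubst[OF assms(1), of "Eq (Mul (lift_tm s) (lift_tm t)) (Mul (Var 0) (lift_tm t))"]
    EqSubst[OF assms(2), of "Eq (Mul (lift_tm s) (lift_tm t)) (Mul (lift_tm s') (Var 0))"]
  by (simp add: inst_def subst_tm_lift EqRefl)

lemma LeSubst:
  assumes "\<Gamma> \<turnstile> Eq s s'" "\<Gamma> \<turnstile> Eq t t'" "\<Gamma> \<turnstile> Le s t"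
  shows "\<Gamma> \<turnstile> Le s' t'"
  using EqSubst[OF assms(1), of "Le (Var 0) (lift_tm t)"]
    EqSubst[OF assms(2), of "Le (lift_tm s') (Var 0)"] assms(3)
  by (simp add: inst_def subst_tm_lift)

lemma eq_uptoE:
  assumes "\<Gamma> \<turnstile> eq_upto t n" "\<And>i. i \<le> n \<Longrightarrow> insert (Eq t (num i)) \<Gamma> \<turnstile> \<chi>"
  shows "\<Gamma> \<turnstile> \<chi>"
  using assms
proof (induction n arbitrary: \<Gamma>)
  case 0
  have "insert (Eq t (num 0)) \<Gamma> \<turnstile> \<chi>" by (rule "0.prems"(2)) simp
  with "0.prems"(1) show ?case by (simp only: eq_upto.simps) (rule cut)
next
  case (Suc n)
  have "\<Gamma> \<turnstile> Disj (eq_upto t n) (Eq t (num (Suc n)))" using Suc.prems(1) by simp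
  moreover have "insert (eq_upto t n) \<Gamma> \<turnstile> \<chi>"
  proof (rule Suc.IH[OF Hyp_insert])
    fix i assume "i \<le> n"
    then have "insert (Eq t (num i)) \<Gamma> \<turnstile> \<chi>" by (simp add: Suc.prems(2))
    then show "insert (Eq t (num i)) (insert (eq_upto t n) \<Gamma>) \<turnstile> \<chi>" by (rule weaken) auto
  qed
  moreover have "insert (Eq t (num (Suc n))) \<Gamma> \<turnstile> \<chi>" by (rule Suc.prems(2)) simp
  ultimately show ?case by (rule DisjE)
qed

section \<open>The standard model and bounded formulas\<close>

primrec tval :: "(nat \<Rightarrow> nat) \<Rightarrow> tm \<Rightarrow> nat" where
  "tval e (Var i) = e i"
| "tval e Zero = 0"
| "tval e (Succ t) = Suc (tval e t)"
| "tval e (Add s t) = tval e s + tval e t"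
| "tval e (Mul s t) = tval e s * tval e t"

primrec sat :: "(nat \<Rightarrow> nat) \<Rightarrow> fm \<Rightarrow> bool" where
  "sat e (Eq s t) \<longleftrightarrow> tval e s = tval e t"
| "sat e Fls \<longleftrightarrow> False"
| "sat e (Imp \<phi> \<psi>) \<longleftrightarrow> (sat e \<phi> \<longrightarrow> sat e \<psi>)"
| "sat e (All \<phi>) \<longleftrightarrow> (\<forall>x. sat (case_nat x e) \<phi>)"

lemma tval_subst: "tval e (subst_tm \<sigma> t) = tval (\<lambda>i. tval e (\<sigma> i)) t"
  by (induction t) auto

lemma tval_lift [simp]: "tval (case_nat x e) (lift_tm t) = tval e t"
  by (simp add: lift_tm_def tval_subst)

lemma tval_num [simp]: "tval e (num n) = n"
  by (induction n) auto

lemma sat_subst: "sat e (subst_fm \<sigma> \<phi>) \<longleftrightarrow> sat (\<lambda>i. tval e (\<sigma> i)) \<phi>"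
proof (induction \<phi> arbitrary: e \<sigma>)
  case (All \<phi>)
  have "(\<lambda>i. tval (case_nat x e) (case_nat (Var 0) (\<lambda>i. lift_tm (\<sigma> i)) i))
      = case_nat x (\<lambda>i. tval e (\<sigma> i))" for x
    by (rule ext) (simp split: nat.split)
  then show ?case by (simp add: All.IH)
qed (simp_all add: tval_subst)

lemma sat_connectives [simp]:
  "sat e (Neg \<phi>) \<longleftrightarrow> \<not> sat e \<phi>"
  "sat e (Disj \<phi> \<psi>) \<longleftrightarrow> sat e \<phi> \<or> sat e \<psi>"
  "sat e (Conj \<phi> \<psi>) \<longleftrightarrow> sat e \<phi> \<and> sat e \<psi>"
  "sat e (Ex \<phi>) \<longleftrightarrow> (\<exists>x. sat (case_nat x e) \<phi>)"
  by (auto simp: Neg_def Disj_def Conj_def Ex_def)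

lemma sat_Le [simp]: "sat e (Le s t) \<longleftrightarrow> tval e s \<le> tval e t"
  by (auto simp: Le_def) (metis le_add_diff_inverse2)

lemma sat_BAll [simp]: "sat e (BAll t \<phi>) \<longleftrightarrow> (\<forall>x\<le>tval e t. sat (case_nat x e) \<phi>)"
  by (simp add: BAll_def)

lemma sat_BEx [simp]: "sat e (BEx t \<phi>) \<longleftrightarrow> (\<exists>x\<le>tval e t. sat (case_nat x e) \<phi>)"
  by (simp add: BEx_def)

text \<open>\<open>Le\<close> counts as atomic although it unfolds to an unbounded existential; this
  is harmless because extensions of R decide it between numerals.\<close>

inductive delta0 :: "fm \<Rightarrow> bool" where
  delta0_Eq: "delta0 (Eq s t)"
| delta0_Le: "delta0 (Le s t)"
| delta0_Fls: "delta0 Fls"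
| delta0_Imp: "delta0 \<phi> \<Longrightarrow> delta0 \<psi> \<Longrightarrow> delta0 (Imp \<phi> \<psi>)"
| delta0_BAll: "delta0 \<phi> \<Longrightarrow> delta0 (BAll t \<phi>)"

lemma delta0_connectives [simp]:
  "delta0 (Eq s t)" "delta0 (Le s t)"
  "delta0 \<phi> \<Longrightarrow> delta0 (Neg \<phi>)"
  "delta0 \<phi> \<Longrightarrow> delta0 \<psi> \<Longrightarrow> delta0 (Disj \<phi> \<psi>)"
  "delta0 \<phi> \<Longrightarrow> delta0 \<psi> \<Longrightarrow> delta0 (Conj \<phi> \<psi>)"
  "delta0 \<phi> \<Longrightarrow> delta0 (BAll t \<phi>)"
  "delta0 \<phi> \<Longrightarrow> delta0 (BEx t \<phi>)"
  by (simp_all add: Neg_def Disj_def Conj_def BEx_def delta0.intros)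

lemma delta0_subst: "delta0 \<phi> \<Longrightarrow> delta0 (subst_fm \<sigma> \<phi>)"
  by (induction arbitrary: \<sigma> rule: delta0.induct) (auto intro: delta0.intros)

section \<open>Decidability of bounded sentences in extensions of R\<close>

locale R_theory =
  fixes U :: "fm set"
  assumes closed: "\<phi> \<in> U \<Longrightarrow> sentence \<phi>"
    and R: "\<phi> \<in> theory_R \<Longrightarrow> U \<turnstile> \<phi>"
begin

lemma R_ext: "U \<subseteq> \<Gamma> \<Longrightarrow> \<phi> \<in> theory_R \<Longrightarrow> \<Gamma> \<turnstile> \<phi>"
  by (rule weaken[OF R])

text \<open>The fourth schema of \<open>theory_R\<close> reduces a term below a numeral to finitely
  many standard values. The term may be a variable and \<open>\<Gamma>\<close> may contain open
  formulas, so the rule also applies to eigenvariables.\<close>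

lemma Le_num_elim:
  assumes "U \<subseteq> \<Gamma>" "\<Gamma> \<turnstile> Le t (num n)" "\<And>i. i \<le> n \<Longrightarrow> insert (Eq t (num i)) \<Gamma> \<turnstile> \<chi>"
  shows "\<Gamma> \<turnstile> \<chi>"
proof -
  have "\<Gamma> \<turnstile> All (Imp (Le (Var 0) (num n)) (eq_upto (Var 0) n))"
    by (rule R_ext[OF assms(1)]) (rule theory_R.intros)
  then have "\<Gamma> \<turnstile> inst (Imp (Le (Var 0) (num n)) (eq_upto (Var 0) n)) t" by (rule AllE)
  then have "\<Gamma> \<turnstile> Imp (Le t (num n)) (eq_upto t n)" by (simp add: inst_def)
  then have "\<Gamma> \<turnstile> eq_upto t n" using assms(2) by (rule ImpE)
  then show ?thesis using assms(3) by (rule eq_uptoE)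
qed

lemma Le_num_linear:
  assumes "U \<subseteq> \<Gamma>"
  shows "\<Gamma> \<turnstile> Disj (Le t (num n)) (Le (num n) t)"
proof -
  have "\<Gamma> \<turnstile> All (Disj (Le (Var 0) (num n)) (Le (num n) (Var 0)))"
    by (rule R_ext[OF assms(1)]) (rule theory_R.intros)
  from AllE[OF this, of t] show ?thesis by (simp add: inst_def)
qed

lemma Le_num:
  assumes "m \<le> n"
  shows "U \<turnstile> Le (num m) (num n)"
proof -
  have "U \<turnstile> Eq (Add (num (n - m)) (num m)) (num (n - m + m))"
    by (rule R) (rule theory_R.intros)
  then have "U \<turnstile> inst (Eq (Add (Var 0) (num m)) (num n)) (num (n - m))"
    using assms by (simp add: inst_def)
  then show ?thesis unfolding Le_def lift_num by (rule ExI)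
qed

lemma Neg_Eq_num: "m \<noteq> n \<Longrightarrow> U \<turnstile> Neg (Eq (num m) (num n))"
  by (rule R) (rule theory_R.intros)

text \<open>Otherwise \<open>num m\<close> would equal some \<open>num i\<close> with
  \<open>i \<le> n\<close>, which the distinctness axioms refute.\<close>

lemma Neg_Le_num:
  assumes "\<not> m \<le> n"
  shows "U \<turnstile> Neg (Le (num m) (num n))"
proof (rule NegI, rule Le_num_elim[OF _ Hyp_insert])
  let ?\<Gamma> = "insert (Le (num m) (num n)) U"
  fix i assume "i \<le> n"
  then have "U \<turnstile> Neg (Eq (num m) (num i))" using assms by (auto intro: Neg_Eq_num)
  then show "insert (Eq (num m) (num i)) ?\<Gamma> \<turnstile> Fls"
    by (rule NegE[OF weaken_insert[OF weaken_insert] Hyp_insert])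
qed auto

lemma Eq_tval: "U \<turnstile> Eq (subst_tm (\<lambda>i. num (e i)) t) (num (tval e t))"
proof (induction t)
  case (Add s t)
  have "U \<turnstile> Eq (Add (num (tval e s)) (num (tval e t))) (num (tval e s + tval e t))"
    by (rule R) (rule theory_R.intros)
  from EqTrans[OF EqAdd[OF Add] this] show ?case by simp
next
  case (Mul s t)
  have "U \<turnstile> Eq (Mul (num (tval e s)) (num (tval e t))) (num (tval e s * tval e t))"
    by (rule R) (rule theory_R.intros)
  from EqTrans[OF EqMul[OF Mul] this] show ?case by simp
qed (simp_all add: EqRefl EqSucc)

text \<open>Both halves go through one induction because an implication uses its premise with
  opposite polarity. A true bounded quantifier splits into finitely many cases, a false one has a
  numeral as counterexample.\<close>

lemma delta0_decided:
  assumes "delta0 \<phi>"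
  shows "(sat e \<phi> \<longrightarrow> U \<turnstile> subst_fm (\<lambda>i. num (e i)) \<phi>) \<and>
    (\<not> sat e \<phi> \<longrightarrow> U \<turnstile> Neg (subst_fm (\<lambda>i. num (e i)) \<phi>))"
  using assms
proof (induction arbitrary: e rule: delta0.induct)
  case (delta0_Eq s t)
  let ?s = "subst_tm (\<lambda>i. num (e i)) s" and ?t = "subst_tm (\<lambda>i. num (e i)) t"
  show ?case
  proof (intro conjI impI)
    assume "sat e (Eq s t)"
    then show "U \<turnstile> subst_fm (\<lambda>i. num (e i)) (Eq s t)"
      using EqTrans[OF Eq_tval[of e s]] EqSym[OF Eq_tval[of e t]] by simp
  next
    assume "\<not> sat e (Eq s t)"
    then have neq: "U \<turnstile> Neg (Eq (num (tval e s)) (num (tval e t)))" by (auto intro: Neg_Eq_num)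
    have "insert (Eq ?s ?t) U \<turnstile> Eq (num (tval e s)) (num (tval e t))"
      by (rule EqTrans[OF EqSym[OF weaken_insert[OF Eq_tval]]
            EqTrans[OF Hyp_insert weaken_insert[OF Eq_tval]]])
    with weaken_insert[OF neq] have "insert (Eq ?s ?t) U \<turnstile> Fls" by (rule NegE)
    then show "U \<turnstile> Neg (subst_fm (\<lambda>i. num (e i)) (Eq s t))" by (simp add: NegI)
  qed
next
  case (delta0_Le s t)
  let ?s = "subst_tm (\<lambda>i. num (e i)) s" and ?t = "subst_tm (\<lambda>i. num (e i)) t"
  show ?case
  proof (intro conjI impI)
    assume "sat e (Le s t)"
    then have "U \<turnstile> Le (num (tval e s)) (num (tval e t))" by (simp add: Le_num)
    then show "U \<turnstile> subst_fm (\<lambda>i. num (e i)) (Le s t)"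
      using LeSubst[OF EqSym[OF Eq_tval[of e s]] EqSym[OF Eq_tval[of e t]]] by simp
  next
    assume "\<not> sat e (Le s t)"
    then have neg: "U \<turnstile> Neg (Le (num (tval e s)) (num (tval e t)))" by (auto intro: Neg_Le_num)
    have "insert (Le ?s ?t) U \<turnstile> Le (num (tval e s)) (num (tval e t))"
      by (rule LeSubst[OF weaken_insert[OF Eq_tval] weaken_insert[OF Eq_tval] Hyp_insert])
    with weaken_insert[OF neg] have "insert (Le ?s ?t) U \<turnstile> Fls" by (rule NegE)
    then show "U \<turnstile> Neg (subst_fm (\<lambda>i. num (e i)) (Le s t))" by (simp add: NegI)
  qed
next
  case delta0_Fls
  then show ?case by (auto intro: NegI Hyp)
next
  case (delta0_Imp \<phi> \<psi>)
  let ?\<phi> = "subst_fm (\<lambda>i. num (e i)) \<phi>" and ?\<psi> = "subst_fm (\<lambda>i. num (e i)) \<psi>"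
  show ?case
  proof (intro conjI impI)
    assume "sat e (Imp \<phi> \<psi>)"
    then have "U \<turnstile> Neg ?\<phi> \<or> U \<turnstile> ?\<psi>" using delta0_Imp.IH[of e] by auto
    then have "insert ?\<phi> U \<turnstile> ?\<psi>"
      by (elim disjE) (rule NegE[OF weaken_insert Hyp_insert] weaken_insert, assumption)+
    then show "U \<turnstile> subst_fm (\<lambda>i. num (e i)) (Imp \<phi> \<psi>)" by (simp add: ImpI)
  next
    assume "\<not> sat e (Imp \<phi> \<psi>)"
    then have *: "U \<turnstile> ?\<phi>" "U \<turnstile> Neg ?\<psi>" using delta0_Imp.IH[of e] by auto
    have "insert (Imp ?\<phi> ?\<psi>) U \<turnstile> ?\<psi>" by (rule ImpE[OF Hyp_insert weaken_insert[OF *(1)]])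
    then have "insert (Imp ?\<phi> ?\<psi>) U \<turnstile> Fls" by (rule NegE[OF weaken_insert[OF *(2)]])
    then show "U \<turnstile> Neg (subst_fm (\<lambda>i. num (e i)) (Imp \<phi> \<psi>))" by (simp add: NegI)
  qed
next
  case (delta0_BAll \<phi> t)
  let ?\<sigma> = "\<lambda>i. num (e i)"
  let ?t = "subst_tm ?\<sigma> t" and ?N = "tval e t"
  let ?\<phi> = "subst_fm (case_nat (Var 0) ?\<sigma>) \<phi>"
  have num_case: "(\<lambda>i. num (case_nat k e i)) = case_nat (num k) ?\<sigma>" for k
    by (rule ext) (simp split: nat.split)
  have form: "subst_fm ?\<sigma> (BAll t \<phi>) = All (Imp (Le (Var 0) ?t) ?\<phi>)"
    by (simp add: BAll_def subst_tm_lift)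
  show ?case
  proof (intro conjI impI)
    assume all: "sat e (BAll t \<phi>)"
    \<comment> \<open>The quantified variable is kept free under the hypothesis that it is at most
      \<open>?t\<close>; once \<open>?t\<close> is replaced by its value, the variable must equal a
      numeral.\<close>
    let ?\<Gamma> = "insert (Le (Var 0) ?t) U"
    have "?\<Gamma> \<turnstile> Le (Var 0) (num ?N)"
      by (rule LeSubst[OF EqRefl weaken_insert[OF Eq_tval] Hyp_insert])
    then have "?\<Gamma> \<turnstile> ?\<phi>"
    proof (rule Le_num_elim[rotated])
      fix i assume "i \<le> ?N"
      with all have "sat (case_nat i e) \<phi>" by simp
      with delta0_BAll.IH[of "case_nat i e"] have "U \<turnstile> subst_fm (case_nat (num i) ?\<sigma>) \<phi>"
        by (simp add: num_case)
      then have "insert (Eq (Var 0) (num i)) ?\<Gamma> \<turnstile> subst_fm (case_nat (num i) ?\<sigma>) \<phi>"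
        by (intro weaken_insert)
      then show "insert (Eq (Var 0) (num i)) ?\<Gamma> \<turnstile> ?\<phi>"
        by (rule replace[where k = 0, rotated 2])
          (auto intro: EqSym[OF Hyp_insert] split: nat.split)
    qed auto
    then show "U \<turnstile> subst_fm ?\<sigma> (BAll t \<phi>)"
      unfolding form by (intro AllI_closed[OF closed] ImpI)
  next
    assume "\<not> sat e (BAll t \<phi>)"
    then obtain i where i: "i \<le> ?N" "\<not> sat (case_nat i e) \<phi>" by auto
    let ?\<psi> = "subst_fm (case_nat (num i) ?\<sigma>) \<phi>"
    let ?\<Gamma> = "insert (subst_fm ?\<sigma> (BAll t \<phi>)) U"
    have neg: "U \<turnstile> Neg ?\<psi>" using i delta0_BAll.IH[of "case_nat i e"] by (simp add: num_case)
    have "?\<Gamma> \<turnstile> inst (Imp (Le (Var 0) ?t) ?\<phi>) (num i)"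
      by (rule AllE) (simp only: form Hyp_insert)
    moreover have "inst (Imp (Le (Var 0) ?t) ?\<phi>) (num i) = Imp (Le (num i) ?t) ?\<psi>"
      using inst_subst_fm[of ?\<sigma> \<phi> "num i"] by (simp add: inst_def subst_tm_comp)
    ultimately have imp: "?\<Gamma> \<turnstile> Imp (Le (num i) ?t) ?\<psi>" by (simp only:)
    have "U \<turnstile> Le (num i) ?t"
      by (rule LeSubst[OF EqRefl EqSym[OF Eq_tval] Le_num[OF i(1)]])
    then have "?\<Gamma> \<turnstile> ?\<psi>" by (rule ImpE[OF imp weaken_insert])
    with weaken_insert[OF neg] have "?\<Gamma> \<turnstile> Fls" by (rule NegE)
    then show "U \<turnstile> Neg (subst_fm ?\<sigma> (BAll t \<phi>))" by (rule NegI)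
  qed
qed


lemma delta0_true: "delta0 \<phi> \<Longrightarrow> sat e \<phi> \<Longrightarrow> U \<turnstile> subst_fm (\<lambda>i. num (e i)) \<phi>"
  using delta0_decided by blast

lemma delta0_false: "delta0 \<phi> \<Longrightarrow> \<not> sat e \<phi> \<Longrightarrow> U \<turnstile> Neg (subst_fm (\<lambda>i. num (e i)) \<phi>)"
  using delta0_decided by blast

end

section \<open>Representability\<close>

text \<open>In a formula \<open>A\<close> the variables 0, 1, 2 stand for the value, the witness and the
  argument of a function. In theories as weak as R uniqueness of the value can be proved only
  for the least witness, because only numbers below a numeral are known to be standard.\<close>

definition least_witness :: "fm \<Rightarrow> fm" where
  "least_witness A = Conj A (Conj (Le (Var 0) (Var 1)) (BAll (Var 1) (Disj (Eq (Var 0) (Var 2))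
     (Neg (subst_fm (case_nat (Var 0) (\<lambda>_. Var 3)) (BEx (Var 0) A))))))"

text \<open>Every index from 2 upwards is sent to the argument, so no stray variables remain and
  three numerals always yield a sentence.\<close>

abbreviation vals :: "'a \<Rightarrow> 'a \<Rightarrow> 'a \<Rightarrow> nat \<Rightarrow> 'a" where
  "vals n z y \<equiv> case_nat y (case_nat z (\<lambda>_. n))"

lemma num_vals: "(\<lambda>i. num (vals n z y i)) = vals (num n) (num z) (num y)"
  by (rule ext) (simp split: nat.split)

lemma num_vals': "(\<lambda>i. num (case_nat z (\<lambda>_. n) i)) = case_nat (num z) (\<lambda>_. num n)"
  by (rule ext) (simp split: nat.split)

lemma delta0_least_witness: "delta0 A \<Longrightarrow> delta0 (least_witness A)"
  by (simp add: least_witness_def delta0_subst del: subst_BEx)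

text \<open>Inside the bounded quantifier of \<open>least_witness\<close> index 0 is the competitor
  \<open>z'\<close>, index 2 is \<open>z\<close> and index 3 is the argument, whence
  \<open>Var 3\<close>. The disjunct \<open>z' = z\<close> restricts the minimality claim to
  strictly smaller competitors.\<close>

lemma sat_least_witness:
  "sat (vals n z y) (least_witness A) \<longleftrightarrow> sat (vals n z y) A \<and> y \<le> z \<and>
    (\<forall>z'\<le>z. z' = z \<or> \<not> (\<exists>y'\<le>z'. sat (vals n z' y') A))"
proof -
  have "(\<lambda>i. tval (case_nat z' (vals n z y)) (case_nat (Var 0) (\<lambda>_. Var (Suc (Suc (Suc 0)))) i)) = case_nat z' (\<lambda>_. n)"
    for z' by (rule ext) (simp split: nat.split)
  then show ?thesis by (simp add: least_witness_def sat_subst eval_nat_numeral del: subst_BEx)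
qed

text \<open>Any witness \<open>s\<close> is comparable with the standard \<open>z0\<close>. If
  \<open>z0\<close> lies below \<open>s\<close>, minimality of \<open>s\<close> forces equality, so
  \<open>s\<close> is at most \<open>z0\<close> in either case. Then \<open>s\<close> and
  \<open>t\<close> range over finitely many numerals, and bounded sentences are decided.\<close>

lemma (in R_theory) represent:
  assumes A: "delta0 A"
    and unique: "\<And>z y. sat (vals n z y) A \<Longrightarrow> y = m"
    and ex: "sat (vals n w m) A" "m \<le> w"
  obtains z0 where "U \<turnstile> subst_fm (vals (num n) (num z0) (num m)) (least_witness A)"
    and "\<And>\<Gamma> s t. U \<subseteq> \<Gamma> \<Longrightarrow> \<Gamma> \<turnstile> subst_fm (vals (num n) s t) (least_witness A) \<Longrightarrow>
           \<Gamma> \<turnstile> Eq t (num m)"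
proof -
  define z0 where "z0 = (LEAST z. \<exists>y\<le>z. sat (vals n z y) A)"
  have z0: "\<exists>y\<le>z0. sat (vals n z0 y) A"
    unfolding z0_def by (rule LeastI[where k = w]) (use ex in auto)
  then have m: "m \<le> z0" "sat (vals n z0 m) A" using unique by auto
  have least: "\<not> (\<exists>y\<le>z. sat (vals n z y) A)" if "z < z0" for z
    using not_less_Least that unfolding z0_def by blast
  have C: "delta0 (least_witness A)" using A by (rule delta0_least_witness)
  have "sat (vals n z0 m) (least_witness A)"
    unfolding sat_least_witness using m least by (auto simp: le_less)
  from delta0_true[OF C this] have 1: "U \<turnstile> subst_fm (vals (num n) (num z0) (num m)) (least_witness A)"
    by (simp only: num_vals)
  \<comment> \<open>This says that some value is found below \<open>z0\<close>. It is provable, so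
    the minimality clause at \<open>z0\<close> leaves only the alternative that \<open>z0\<close>
    equals \<open>s\<close>.\<close>
  let ?B = "subst_fm (case_nat (num z0) (\<lambda>_. num n)) (BEx (Var 0) A)"
  have "sat (case_nat z0 (\<lambda>_. n)) (BEx (Var 0) A)" using z0 by simp
  from delta0_true[OF _ this] A have B: "U \<turnstile> ?B" by (simp only: num_vals' delta0_connectives)
  have "\<Gamma> \<turnstile> Eq t (num m)"
    if U: "U \<subseteq> \<Gamma>" and hyp: "\<Gamma> \<turnstile> subst_fm (vals (num n) s t) (least_witness A)" for \<Gamma> s t
  proof -
    let ?\<sigma> = "vals (num n) s t"
    let ?\<psi> = "Disj (Eq (Var 0) (Var 2)) (Neg (subst_fm (case_nat (Var 0) (\<lambda>_. Var 3)) (BEx (Var 0) A)))"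
    have "subst_fm ?\<sigma> (least_witness A) =
        Conj (subst_fm ?\<sigma> A) (Conj (Le t s) (subst_fm ?\<sigma> (BAll (Var 1) ?\<psi>)))"
      by (simp add: least_witness_def)
    with hyp have "\<Gamma> \<turnstile> Conj (Le t s) (subst_fm ?\<sigma> (BAll (Var 1) ?\<psi>))" by (metis ConjD2)
    then have ts: "\<Gamma> \<turnstile> Le t s" and all: "\<Gamma> \<turnstile> subst_fm ?\<sigma> (BAll (Var 1) ?\<psi>)"
      by (rule ConjD1, rule ConjD2)
    let ?\<Delta> = "insert (Le (num z0) s) \<Gamma>"
    have "subst_fm ?\<sigma> (BAll (Var 1) ?\<psi>)
        = All (Imp (Le (Var 0) (lift_tm s)) (subst_fm (case_nat (Var 0) (\<lambda>i. lift_tm (?\<sigma> i))) ?\<psi>))"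
      by (simp add: BAll_def subst_tm_lift)
    with all have "\<Gamma> \<turnstile> inst (Imp (Le (Var 0) (lift_tm s))
        (subst_fm (case_nat (Var 0) (\<lambda>i. lift_tm (?\<sigma> i))) ?\<psi>)) (num z0)"
      by (metis AllE)
    moreover have "inst (Imp (Le (Var 0) (lift_tm s))
        (subst_fm (case_nat (Var 0) (\<lambda>i. lift_tm (?\<sigma> i))) ?\<psi>)) (num z0)
        = Imp (Le (num z0) s) (subst_fm (case_nat (num z0) ?\<sigma>) ?\<psi>)"
      using inst_subst_fm[of ?\<sigma> ?\<psi> "num z0"] by (simp add: inst_def subst_tm_lift)
    moreover have "subst_fm (case_nat (num z0) ?\<sigma>) ?\<psi> = Disj (Eq (num z0) s) (Neg ?B)"
    proof -
      have "(\<lambda>i. subst_tm (case_nat (num z0) ?\<sigma>) (case_nat (Var 0) (\<lambda>_. Var (Suc (Suc (Suc 0)))) i))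
          = case_nat (num z0) (\<lambda>_. num n)"
        by (rule ext) (simp split: nat.split)
      then show ?thesis by (simp add: subst_fm_comp eval_nat_numeral del: subst_BEx)
    qed
    ultimately have "\<Gamma> \<turnstile> Imp (Le (num z0) s) (Disj (Eq (num z0) s) (Neg ?B))" by (simp only:)
    then have "?\<Delta> \<turnstile> Disj (Eq (num z0) s) (Neg ?B)"
      by (rule ImpE[OF weaken_insert Hyp_insert])
    then have "?\<Delta> \<turnstile> Le s (num z0)"
    proof (rule DisjE)
      let ?\<Theta> = "insert (Eq (num z0) s) ?\<Delta>"
      have "U \<subseteq> ?\<Theta>" using U by auto
      then have "?\<Theta> \<turnstile> Le (num z0) (num z0)" using Le_num[of z0 z0] by (auto intro: weaken)
      then show "?\<Theta> \<turnstile> Le s (num z0)" by (rule LeSubst[OF Hyp_insert EqRefl])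
    next
      let ?\<Theta> = "insert (Neg ?B) ?\<Delta>"
      have "?\<Theta> \<turnstile> ?B" using B U by (auto intro: weaken simp del: subst_BEx)
      then show "?\<Theta> \<turnstile> Le s (num z0)" by (rule NegE[OF Hyp_insert])
    qed
    then have "\<Gamma> \<turnstile> Le s (num z0)" by (rule DisjE[OF Le_num_linear[OF U] Hyp_insert])
    then show ?thesis
    proof (rule Le_num_elim[OF U])
      fix i
      let ?\<Theta> = "insert (Eq s (num i)) \<Gamma>"
      have "?\<Theta> \<turnstile> Le t (num i)" by (rule LeSubst[OF EqRefl Hyp_insert weaken_insert[OF ts]])
      then show "?\<Theta> \<turnstile> Eq t (num m)"
      proof (rule Le_num_elim[rotated])
        fix j
        let ?\<Lambda> = "insert (Eq t (num j)) ?\<Theta>"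
        \<comment> \<open>A pair of numerals that satisfies the formula in the standard model has
          \<open>j = m\<close>; any other pair is refuted by \<open>U\<close>, against
          \<open>hyp\<close> with both terms replaced by numerals.\<close>
        show "?\<Lambda> \<turnstile> Eq t (num m)"
        proof (cases "sat (vals n i j) (least_witness A)")
          case True
          then have "sat (vals n i j) A" by (simp add: sat_least_witness)
          then have "j = m" by (rule unique)
          then show ?thesis using Hyp_insert by simp
        next
          case False
          from delta0_false[OF C this]
          have no: "U \<turnstile> Neg (subst_fm (vals (num n) (num i) (num j)) (least_witness A))"
            by (simp only: num_vals)
          have "?\<Lambda> \<turnstile> subst_fm ?\<sigma> (least_witness A)"
            by (rule weaken_insert[OF weaken_insert[OF hyp]])
          then have "?\<Lambda> \<turnstile> subst_fm (vals (num n) s (num j)) (least_witness A)"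
            by (rule replace[where k = 0, rotated 2]) (auto simp: Hyp_insert split: nat.split)
          then have "?\<Lambda> \<turnstile> subst_fm (vals (num n) (num i) (num j)) (least_witness A)"
            by (rule replace[where k = 1, rotated 2])
              (auto simp: weaken_insert[OF Hyp_insert] split: nat.split)
          moreover have "?\<Lambda> \<turnstile> Neg (subst_fm (vals (num n) (num i) (num j)) (least_witness A))"
            using no by (rule weaken) (use U in auto)
          ultimately show ?thesis by (rule NegE[rotated])
        qed
      qed (use U in auto)
    qed
  qed
  with 1 show thesis by (rule that)
qed

section \<open>The graph of the diagonal function\<close>

text \<open>Goedel's beta function. Two moduli differ by \<open>(j - i) * d\<close>, which is
  coprime to each of them, so the Chinese remainder theorem supplies \<open>c\<close>.\<close>

lemma beta_exists:
  fixes f :: "nat \<Rightarrow> nat"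
  shows "\<exists>c d. \<forall>i\<le>n. c mod Suc (Suc i * d) = f i"
proof -
  \<comment> \<open>The factorial makes every \<open>j - i\<close> divide \<open>d\<close>, and the
    sum makes \<open>d\<close> at least every \<open>f i\<close>, so each \<open>f i\<close> is
    smaller than its modulus.\<close>
  define d :: nat where "d = fact (n + sum f {..n})"
  have cop: "coprime (Suc (Suc i * d)) (Suc (Suc j * d))" if "i < j" "j \<le> n" for i j
  proof -
    have "coprime (Suc (Suc i * d)) d"
      by (metis coprime_Suc_left_nat coprime_commute coprime_mult_right_iff mult.commute)
    moreover have "j - i dvd d" unfolding d_def using that by (intro dvd_fact) auto
    ultimately have "coprime (Suc (Suc i * d)) ((j - i) * d)"
      by (metis coprime_divisors coprime_mult_right_iff dvd_refl)
    moreover have "Suc (Suc j * d) = Suc (Suc i * d) + (j - i) * d"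
      using that by (metis add_Suc add_mult_distrib le_add_diff_inverse less_or_eq_imp_le Suc_leI
        add_Suc_shift Suc_diff_Suc)
    ultimately show ?thesis by (metis coprime_iff_gcd_eq_1 gcd_add2)
  qed
  have "\<exists>c. \<forall>i\<in>{..n}. [c = f i] (mod Suc (Suc i * d))"
  proof (rule chinese_remainder_nat)
    show "\<forall>i\<in>{..n}. \<forall>j\<in>{..n}. i \<noteq> j \<longrightarrow> coprime (Suc (Suc i * d)) (Suc (Suc j * d))"
      by (metis atMost_iff cop coprime_commute nat_neq_iff)
  qed auto
  then obtain c where c: "[c = f i] (mod Suc (Suc i * d))" if "i \<le> n" for i by auto
  have "c mod Suc (Suc i * d) = f i" if "i \<le> n" for i
  proof -
    have "f i \<le> sum f {..n}" using that by (intro member_le_sum) auto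
    also have "\<dots> \<le> n + sum f {..n}" by simp
    also have "\<dots> \<le> d" unfolding d_def by (rule fact_ge_self)
    finally have "f i < Suc (Suc i * d)" by simp
    with c[OF that] show ?thesis by (simp add: cong_def)
  qed
  then show ?thesis by blast
qed

text \<open>Division with remainder: the first conjunct puts \<open>r\<close> below the modulus 1 +
  (i + 1) d, and the quotient can be bounded by \<open>c\<close>.\<close>

definition Beta :: "tm \<Rightarrow> tm \<Rightarrow> tm \<Rightarrow> tm \<Rightarrow> fm" where
  "Beta c d i r = Conj (Le r (Mul (Succ i) d)) (BEx c (Eq (lift_tm c)
     (Add (Mul (Var 0) (Succ (Mul (Succ (lift_tm i)) (lift_tm d)))) (lift_tm r))))"

text \<open>Cantor's pairing function with both sides doubled, which removes the halving in the
  triangular number.\<close>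

definition Pair :: "tm \<Rightarrow> tm \<Rightarrow> tm \<Rightarrow> fm" where
  "Pair s t u = Eq (Mul (num 2) u) (Add (Mul (Add s t) (Succ (Add s t))) (Mul (num 2) s))"

lemma sat_Beta [simp]:
  "sat e (Beta c d i r) \<longleftrightarrow> tval e r = tval e c mod Suc (Suc (tval e i) * tval e d)"
proof -
  have "r \<le> p \<and> (\<exists>q\<le>c. c = q * Suc p + r) \<longleftrightarrow> r = c mod Suc p" for r p c :: nat
  proof
    assume "r = c mod Suc p"
    moreover have "c = c div Suc p * Suc p + c mod Suc p" by (simp only: div_mult_mod_eq)
    moreover have "c div Suc p \<le> c" by (rule div_le_dividend)
    moreover have "c mod Suc p \<le> p" using mod_less_divisor[of "Suc p" c] by linarith
    ultimately show "r \<le> p \<and> (\<exists>q\<le>c. c = q * Suc p + r)" by metis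
  next
    assume "r \<le> p \<and> (\<exists>q\<le>c. c = q * Suc p + r)"
    then show "r = c mod Suc p" by (metis le_imp_less_Suc mod_less mod_mult_self3)
  qed
  from this[of "tval e r" "Suc (tval e i) * tval e d" "tval e c"]
  show ?thesis by (simp add: Beta_def)
qed

lemma sat_Pair [simp]: "sat e (Pair s t u) \<longleftrightarrow> tval e u = prod_encode (tval e s, tval e t)"
proof -
  have "2 * triangle k = k * Suc k" for k by (simp add: triangle_def)
  from this[of "tval e s + tval e t"] show ?thesis by (auto simp: Pair_def prod_encode_def)
qed

text \<open>Through beta, \<open>c\<close> and \<open>d\<close> code the sequence of codes of the
  numerals from 0 to \<open>x\<close>, ending in \<open>a\<close>; the tag 2 belongs to
  \<open>Succ\<close>. Entries can be sought below \<open>c\<close> because they are remainders of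
  \<open>c\<close>.\<close>

definition Trace :: "tm \<Rightarrow> tm \<Rightarrow> tm \<Rightarrow> tm \<Rightarrow> fm" where
  "Trace x c d a = Conj (Beta c d Zero (num (gn_tm Zero))) (Conj (Beta c d x a)
     (BAll x (Disj (Eq (Var 0) (lift_tm x))
       (let c' = lift_tm (lift_tm (lift_tm c)); d' = lift_tm (lift_tm (lift_tm d)) in
        BEx (lift_tm c) (BEx (lift_tm (lift_tm c))
          (Conj (Beta c' d' (Var 2) (Var 1)) (Conj (Beta c' d' (Succ (Var 2)) (Var 0))
            (Pair (num 2) (Var 1) (Var 0)))))))))"

lemma sat_Trace:
  assumes "sat e (Trace x c d a)"
  shows "tval e a = gn_tm (num (tval e x))"
proof -
  let ?\<beta> = "\<lambda>i. tval e c mod Suc (Suc i * tval e d)"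
  have step: "?\<beta> (Suc i) = prod_encode (2, ?\<beta> i)" if "i < tval e x" for i
  proof -
    have "\<forall>i\<le>tval e x. i = tval e x \<or> ?\<beta> (Suc i) = prod_encode (2, ?\<beta> i)"
      using assms by (auto simp: Trace_def Let_def eval_nat_numeral)
    with that show ?thesis by (metis less_imp_le less_irrefl)
  qed
  have "?\<beta> i = gn_tm (num i)" if "i \<le> tval e x" for i
    using that
  proof (induction i)
    case 0
    then show ?case using assms by (simp add: Trace_def)
  next
    case (Suc i)
    then show ?case using step[of i] by simp
  qed
  with assms show ?thesis by (simp add: Trace_def)
qed

text \<open>The numbers \<open>c\<close> and \<open>d\<close> are fixed before environment and
  terms, so that they can serve as values of the bounded quantifiers in \<open>Diag\<close>.\<close>

lemma sat_Trace_exists: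
  "\<exists>c d. \<forall>e x' c' d' a. tval e x' = n \<longrightarrow> tval e c' = c \<longrightarrow> tval e d' = d \<longrightarrow>
     tval e a = gn_tm (num n) \<longrightarrow> sat e (Trace x' c' d' a)"
proof -
  obtain c d where *: "c mod Suc (Suc i * d) = gn_tm (num i)" if "i \<le> n" for i
    using beta_exists[of n "\<lambda>i. gn_tm (num i)"] by blast
  have "\<exists>x\<le>c. \<exists>y\<le>c. x = c mod Suc (Suc i * d) \<and> y = c mod Suc (Suc (Suc i) * d) \<and>
      y = prod_encode (2, x)" if "i < n" for i
    using that *[of i] *[of "Suc i"] by (metis Suc_leI gn_tm.simps(3) less_imp_le mod_less_eq_dividend num.simps(2))
  then show ?thesis
    using *[of 0] *[of n]
    by (intro exI[of _ c] exI[of _ d]) (fastforce simp: Trace_def Let_def eval_nat_numeral le_less)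
qed

text \<open>The code of \<open>\<forall>x. x = num n \<longrightarrow> \<phi>\<close> is assembled from \<open>n = gn \<phi>\<close> and \<open>a = gn_tm (num n)\<close>; the
  four bound variables are the codes of the intermediate expressions.\<close>

definition Diag_code :: "tm \<Rightarrow> tm \<Rightarrow> tm \<Rightarrow> fm" where
  "Diag_code a x y =
    (let l = lift_tm; a' = l (l (l (l a))); x' = l (l (l (l x))); y' = l (l (l (l y))) in
     BEx y (BEx (l y) (BEx (l (l y)) (BEx (l (l (l y)))
       (Conj (Pair (num (gn_tm (Var 0))) a' (Var 0)) (Conj (Pair Zero (Var 0) (Var 1))
         (Conj (Pair (Var 1) x' (Var 2)) (Conj (Pair (num 2) (Var 2) (Var 3))
           (Pair (num 3) (Var 3) y')))))))))"

text \<open>Below the quantifiers, indices 0, 1, 2 are \<open>d\<close>, \<open>c\<close> and the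
  code of the numeral; 3, 4, 5 are value, witness and argument. The one witness bounds all three
  searches.\<close>

definition Diag :: fm where
  "Diag = BEx (Var 1) (BEx (Var 2) (BEx (Var 3)
     (Conj (Trace (Var 5) (Var 1) (Var 0) (Var 2)) (Diag_code (Var 2) (Var 5) (Var 3)))))"

text \<open>Equivalent to instantiating \<open>\<phi>\<close> with the numeral of its own code, but
  the code of this form is built by pairing, without arithmetizing substitution.\<close>

definition diag :: "fm \<Rightarrow> fm" where
  "diag \<phi> = All (Imp (Eq (Var 0) (num (gn \<phi>))) \<phi>)"

definition diag_gn :: "nat \<Rightarrow> nat" where
  "diag_gn n = prod_encode (3, prod_encode (2, prod_encode
     (prod_encode (0, prod_encode (gn_tm (Var 0), gn_tm (num n))), n)))"

lemma gn_diag: "gn (diag \<phi>) = diag_gn (gn \<phi>)"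
  by (simp add: diag_def diag_gn_def)

lemma delta0_Diag: "delta0 Diag"
  by (simp add: Diag_def Diag_code_def Trace_def Beta_def Pair_def Let_def)

lemma sat_Diag_code:
  assumes "tval e a = gn_tm (num (tval e x))"
  shows "sat e (Diag_code a x y) \<longleftrightarrow> tval e y = diag_gn (tval e x)"
proof
  assume "sat e (Diag_code a x y)"
  then show "tval e y = diag_gn (tval e x)"
    using assms by (auto simp: Diag_code_def Let_def diag_gn_def eval_nat_numeral)
next
  assume y: "tval e y = diag_gn (tval e x)"
  define u1 where "u1 = prod_encode (gn_tm (Var 0), gn_tm (num (tval e x)))"
  define u2 where "u2 = prod_encode (0, u1)"
  define u3 where "u3 = prod_encode (u2, tval e x)"
  define u4 where "u4 = prod_encode (2, u3)"
  have y4: "tval e y = prod_encode (3, u4)"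
    using y by (simp add: diag_gn_def u1_def u2_def u3_def u4_def)
  \<comment> \<open>Pairing never falls below its components, so \<open>y\<close> bounds every
    intermediate code.\<close>
  have "u1 \<le> u2" "u2 \<le> u3" "u3 \<le> u4" "u4 \<le> tval e y"
    by (simp_all add: u2_def u3_def u4_def y4 le_prod_encode_1 le_prod_encode_2)
  then have le: "u1 \<le> tval e y" "u2 \<le> tval e y" "u3 \<le> tval e y" "u4 \<le> tval e y" by auto
  show "sat e (Diag_code a x y)"
    unfolding Diag_code_def Let_def sat_BEx tval_lift
    by (intro exI[of _ u4] exI[of _ u3] exI[of _ u2] exI[of _ u1] conjI le)
      (use assms y4 in \<open>simp add: eval_nat_numeral u1_def u2_def u3_def u4_def\<close>)
qed

lemma sat_Diag: "sat (vals n z y) Diag \<Longrightarrow> y = diag_gn n"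
  by (auto simp: Diag_def sat_Diag_code dest!: sat_Trace)

text \<open>The witness must also bound the value, as \<open>least_witness\<close> demands; the sum
  of all numbers involved does so.\<close>

lemma sat_Diag_exists: "\<exists>w\<ge>diag_gn n. sat (vals n w (diag_gn n)) Diag"
proof -
  obtain c d where cd: "\<And>e x' c' d' a. tval e x' = n \<Longrightarrow> tval e c' = c \<Longrightarrow> tval e d' = d \<Longrightarrow>
      tval e a = gn_tm (num n) \<Longrightarrow> sat e (Trace x' c' d' a)"
    using sat_Trace_exists[of n] by blast
  let ?a = "gn_tm (num n)"
  let ?w = "?a + c + d + diag_gn n"
  have "sat (vals n ?w (diag_gn n)) Diag"
    unfolding Diag_def sat_BEx
    by (intro exI[of _ ?a] exI[of _ c] exI[of _ d] conjI)
      (simp_all add: cd sat_Diag_code eval_nat_numeral)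
  then show ?thesis by (intro exI[of _ ?w]) auto
qed

section \<open>The diagonal lemma\<close>

lemma inst_Var_0: "fv \<phi> \<subseteq> {0} \<Longrightarrow> inst \<phi> (Var 0) = \<phi>"
  using subst_fm_cong[of \<phi> "case_nat (Var 0) Var" Var] by (force simp: inst_def)

lemma sentence_inst_num: "fv \<phi> \<subseteq> {0} \<Longrightarrow> sentence (inst \<phi> (num n))"
  by (auto simp: sentence_def inst_def fv_subst_fm)

text \<open>Let \<open>\<phi>\<close> say of a code that every value of the diagonal function there
  satisfies \<open>\<rho>\<close>. The fixed point is \<open>diag \<phi>\<close>, since the value at
  the code of \<open>\<phi>\<close> is the code of \<open>diag \<phi>\<close> itself.\<close>

lemma (in R_theory) diagonal:
  assumes \<rho>: "fv \<rho> \<subseteq> {0}"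
  obtains \<theta> where "sentence \<theta>" "insert \<theta> U \<turnstile> inst \<rho> (gquote \<theta>)" "insert (inst \<rho> (gquote \<theta>)) U \<turnstile> \<theta>"
proof -
  define C where "C = least_witness Diag"
  \<comment> \<open>Value and witness have indices 0 and 1 and are bound by the two quantifiers of
    \<open>\<phi>\<close>; the argument at index 2 thereby becomes its index 0.\<close>
  define body where "body = Imp (subst_fm (vals (Var 2) (Var 1) (Var 0)) C) \<rho>"
  define \<phi> where "\<phi> = All (All body)"
  define n where "n = gn \<phi>"
  define m where "m = gn (diag \<phi>)"
  have m: "m = diag_gn n" by (simp add: m_def n_def gn_diag)
  let ?\<rho>m = "inst \<rho> (num m)"
  let ?C = "\<lambda>s t. subst_fm (vals (num n) s t) C"
  obtain w where w: "m \<le> w" "sat (vals n w m) Diag" using sat_Diag_exists m by blast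
  have unique: "y = m" if "sat (vals n z y) Diag" for z y using sat_Diag[OF that] m by simp
  obtain z0 where C0: "U \<turnstile> ?C (num z0) (num m)"
    and C_unique: "\<And>\<Gamma> s t. U \<subseteq> \<Gamma> \<Longrightarrow> \<Gamma> \<turnstile> ?C s t \<Longrightarrow> \<Gamma> \<turnstile> Eq t (num m)"
    unfolding C_def by (rule represent[OF delta0_Diag _ w(2,1)]) (erule unique, blast)
  have fv_body: "fv body \<subseteq> {0, 1, 2}"
    using \<rho> by (auto simp: body_def fv_subst_fm split: nat.splits)
  then have fv_\<phi>: "fv \<phi> \<subseteq> {0}" by (auto simp: \<phi>_def)
  have "sentence (diag \<phi>)" using fv_\<phi> by (auto simp: sentence_def diag_def)
  have \<rho>_subst: "subst_fm \<sigma> \<rho> = inst \<rho> (\<sigma> 0)" for \<sigma>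
    unfolding inst_def using \<rho> by (intro subst_fm_cong) auto
  have subst_body: "subst_fm (vals (num n) s t) body = Imp (?C s t) (inst \<rho> t)" for s t
  proof -
    have "(\<lambda>i. subst_tm (vals (num n) s t) (vals (Var 2) (Var 1) (Var 0) i)) = vals (num n) s t"
      by (rule ext) (simp add: eval_nat_numeral split: nat.split)
    then show ?thesis by (simp add: body_def subst_fm_comp \<rho>_subst del: One_nat_def)
  qed
  let ?D = "All (All (Imp (?C (Var 1) (Var 0)) \<rho>))"
  have "inst \<phi> (num n) = All (All (subst_fm (vals (num n) (Var 1) (Var 0)) body))"
  proof -
    have "subst_fm (case_nat (Var 0) (\<lambda>i. lift_tm
          (case_nat (Var 0) (\<lambda>i. lift_tm (case_nat (num n) Var i)) i))) body
        = subst_fm (vals (num n) (Var 1) (Var 0)) body"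
      by (rule subst_fm_cong) (use fv_body in \<open>auto simp: eval_nat_numeral\<close>)
    then show ?thesis by (simp add: inst_def \<phi>_def)
  qed
  then have inst_\<phi>: "inst \<phi> (num n) = ?D" by (simp add: subst_body inst_Var_0[OF \<rho>])

  have "insert (diag \<phi>) U \<turnstile> ?\<rho>m"
  proof -
    let ?\<Gamma> = "insert (diag \<phi>) U"
    \<comment> \<open>At the code of \<open>\<phi>\<close> the premise is reflexivity; afterwards
      \<open>z0\<close> and \<open>m\<close> instantiate the witness and the value.\<close>
    have "?\<Gamma> \<turnstile> inst (Imp (Eq (Var 0) (num n)) \<phi>) (num n)"
      by (rule AllE) (simp add: diag_def n_def Hyp_insert)
    then have "?\<Gamma> \<turnstile> Imp (Eq (num n) (num n)) (inst \<phi> (num n))" by (simp add: inst_def)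
    then have "?\<Gamma> \<turnstile> ?D" using EqRefl unfolding inst_\<phi> by (rule ImpE)
    then have "?\<Gamma> \<turnstile> inst (All (Imp (?C (Var 1) (Var 0)) \<rho>)) (num z0)" by (rule AllE)
    moreover have "inst (All (Imp (?C (Var 1) (Var 0)) \<rho>)) (num z0)
        = All (Imp (?C (num z0) (Var 0)) \<rho>)"
    proof -
      have "(\<lambda>i. subst_tm (case_nat (Var 0) (\<lambda>i. lift_tm (case_nat (num z0) Var i)))
            (vals (num n) (Var 1) (Var 0) i))
          = vals (num n) (num z0) (Var 0)"
        by (rule ext) (simp split: nat.split)
      then show ?thesis
        by (simp add: inst_def[of "All _"] subst_fm_comp \<rho>_subst inst_Var_0[OF \<rho>] del: One_nat_def)
    qed
    ultimately have "?\<Gamma> \<turnstile> All (Imp (?C (num z0) (Var 0)) \<rho>)" by (simp only:)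
    then have "?\<Gamma> \<turnstile> inst (Imp (?C (num z0) (Var 0)) \<rho>) (num m)" by (rule AllE)
    moreover have "inst (Imp (?C (num z0) (Var 0)) \<rho>) (num m) = Imp (?C (num z0) (num m)) ?\<rho>m"
    proof -
      have "(\<lambda>i. subst_tm (case_nat (num m) Var) (vals (num n) (num z0) (Var 0) i))
          = vals (num n) (num z0) (num m)"
        by (rule ext) (simp split: nat.split)
      then show ?thesis by (simp add: inst_def subst_fm_comp)
    qed
    ultimately have "?\<Gamma> \<turnstile> Imp (?C (num z0) (num m)) ?\<rho>m" by (simp only:)
    then show ?thesis using weaken_insert[OF C0] by (rule ImpE)
  qed
  moreover have "insert ?\<rho>m U \<turnstile> diag \<phi>"
  proof -
    let ?\<Gamma> = "insert ?\<rho>m U"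
    have \<Gamma>: "sentence \<psi>" if "\<psi> \<in> ?\<Gamma>" for \<psi> using that closed sentence_inst_num[OF \<rho>] by blast
    let ?\<Delta> = "insert (?C (Var 1) (Var 0)) ?\<Gamma>"
    \<comment> \<open>Witness and value are variables here and possibly nonstandard, so uniqueness
      for arbitrary terms is essential.\<close>
    have "?\<Delta> \<turnstile> Eq (Var 0) (num m)" by (rule C_unique[OF _ Hyp_insert]) auto
    from EqSubst[OF EqSym[OF this] weaken_insert[OF Hyp_insert]]
    have "?\<Delta> \<turnstile> \<rho>" by (simp only: inst_Var_0[OF \<rho>])
    then have D: "?\<Gamma> \<turnstile> ?D" by (intro AllI_closed[OF \<Gamma>] ImpI)
    let ?\<Theta> = "insert (Eq (Var 0) (num n)) ?\<Gamma>"
    have "?\<Theta> \<turnstile> inst \<phi> (num n)" unfolding inst_\<phi> by (rule weaken_insert[OF D])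
    from EqSubst[OF EqSym[OF Hyp_insert] this] have "?\<Theta> \<turnstile> \<phi>" by (simp only: inst_Var_0[OF fv_\<phi>])
    then show ?thesis unfolding diag_def n_def[symmetric] by (intro AllI_closed[OF \<Gamma>] ImpI)
  qed
  ultimately show thesis using \<open>sentence (diag \<phi>)\<close> by (intro that[of "diag \<phi>"]) (simp_all add: gquote_def m_def)
qed

theorem theorem2p1:
  fixes U :: "fm set"
  assumes "is_theory U"
    and "consistent U"
    and "extends U theory_R"
  shows "\<not> (\<exists>\<rho>. extensional_Rosser_formula U \<rho>)"
proof
  assume "\<exists>\<rho>. extensional_Rosser_formula U \<rho>"
  then obtain \<rho> where \<rho>: "fv \<rho> \<subseteq> {0}" and ind: "independence U \<rho>" and ext: "extensionality U \<rho>"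
    unfolding extensional_Rosser_formula_def by blast
  interpret R_theory U
  proof
    show "sentence \<phi>" if "\<phi> \<in> U" for \<phi> using assms(1) that by (simp add: is_theory_def)
    show "U \<turnstile> \<phi>" if "\<phi> \<in> theory_R" for \<phi>
      using assms(3) that by (simp add: extends_def sentence_theory_R Hyp)
  qed
  \<comment> \<open>Were \<open>\<theta>\<close> consistent with \<open>U\<close>, independence
    would forbid \<open>U\<close> with \<open>\<theta>\<close> to prove either alternative.\<close>
  have refuted: "U \<turnstile> Neg \<theta>"
    if "sentence \<theta>" "insert \<theta> U \<turnstile> inst \<rho> (gquote \<theta>) \<or> insert \<theta> U \<turnstile> Neg (inst \<rho> (gquote \<theta>))" for \<theta>
  proof (rule ccontr)
    assume "\<not> U \<turnstile> Neg \<theta>"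
    then have "consistent (U \<union> {\<theta>})" by (auto simp: consistent_def dest: NegI)
    with ind that(1) have "consistent (insert (inst \<rho> (gquote \<theta>)) (insert \<theta> U))"
      and "consistent (insert (Neg (inst \<rho> (gquote \<theta>))) (insert \<theta> U))"
      by (simp_all add: independence_def)
    with that(2) show False
      unfolding consistent_def by (meson Hyp_insert NegE weaken_insert)
  qed
  have Fls_eq: "U \<turnstile> Iff (inst \<rho> (gquote \<theta>)) (inst \<rho> (gquote Fls))"
    if "sentence \<theta>" "U \<turnstile> Neg \<theta>" for \<theta>
  proof -
    have "U \<turnstile> Iff \<theta> Fls" unfolding Iff_def
      by (rule ConjI[OF that(2)[unfolded Neg_def] ImpI[OF FlsE[OF Hyp_insert]]])
    with ext that(1) show ?thesis by (simp add: extensionality_def sentence_def)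
  qed
  have "U \<turnstile> Neg (inst \<rho> (gquote Fls))"
  proof -
    obtain \<theta> where \<theta>: "sentence \<theta>" "insert \<theta> U \<turnstile> inst \<rho> (gquote \<theta>)" "insert (inst \<rho> (gquote \<theta>)) U \<turnstile> \<theta>"
      using diagonal[OF \<rho>] by blast
    then have no: "U \<turnstile> Neg \<theta>" using refuted by blast
    \<comment> \<open>The converse half of the fixed point carries the refutation of
      \<open>\<theta>\<close> over to its image under \<open>\<rho>\<close>.\<close>
    have no': "U \<turnstile> Neg (inst \<rho> (gquote \<theta>))" by (rule NegI, rule NegE[OF weaken_insert[OF no] \<theta>(3)])
    from Fls_eq[OF \<theta>(1) no] have "U \<turnstile> Imp (inst \<rho> (gquote Fls)) (inst \<rho> (gquote \<theta>))"
      unfolding Iff_def by (rule ConjD2)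
    from ImpE[OF weaken_insert[OF this] Hyp_insert] show ?thesis
      by (intro NegI) (rule NegE[OF weaken_insert[OF no']])
  qed
  moreover have "U \<turnstile> inst \<rho> (gquote Fls)"
  proof -
    have inst_Neg: "inst (Neg \<rho>) t = Neg (inst \<rho> t)" for t by (simp add: inst_def)
    obtain \<theta> where \<theta>: "sentence \<theta>" "insert \<theta> U \<turnstile> Neg (inst \<rho> (gquote \<theta>))"
        "insert (Neg (inst \<rho> (gquote \<theta>))) U \<turnstile> \<theta>"
      using diagonal[of "Neg \<rho>"] \<rho> by (auto simp: inst_Neg)
    then have no: "U \<turnstile> Neg \<theta>" using refuted by blast
    \<comment> \<open>Here the negated image implies the refuted \<open>\<theta>\<close>, so the
      image itself follows classically.\<close>
    have yes: "U \<turnstile> inst \<rho> (gquote \<theta>)" by (rule Raa, rule NegE[OF weaken_insert[OF no] \<theta>(3)])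
    from Fls_eq[OF \<theta>(1) no] have "U \<turnstile> Imp (inst \<rho> (gquote \<theta>)) (inst \<rho> (gquote Fls))"
      unfolding Iff_def by (rule ConjD1)
    then show ?thesis using yes by (rule ImpE)
  qed
  ultimately have "U \<turnstile> Fls" by (rule NegE)
  with assms(2) show False by (simp add: consistent_def)
qed

end
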